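(* Let $f:\mathbb{R}^d\to\mathbb{R}$ be differentiable and bounded below, and consider the problem $\min_{x\in\mathbb{R}^d}f(x)$. If $\hat F:\mathbb{R}^+\to\mathbb{R}^+$ is (differentiable and) strictly increasing, then the gAEGD update rule is unconditionally energy stable. Specifically, for any step size $\eta>0$, the following identity holds: $$r_{k+1}^2 = r_k^2 - (r_{k+1}-r_k)^2 - \frac{2}{\eta}F_kF'_k\,\|x_{k+1}-x_k\|^2 .$$ In particular, the sequence $\{r_k\}$ is strictly decreasing and converges to a non-negative limit $r^*$, i.e., $r_k\to r^*$ as $k\to\infty$.
   Context: $\mathbb{R}^+=(0,\infty)$ and $\|\cdot\|$ is the Euclidean norm. Let $f^*=\inf_{x}f(x)$ and fix $c\in\mathbb{R}$ with $f^*+c>0$. The gAEGD update rule: given $x_0\in\mathbb{R}^d$, $r_0>0$ and $\eta>0$, for $k\ge 0$ put $F_k=\hat F(f(x_k)+c)$, $F'_k=\hat F'(f(x_k)+c)$, and $$r_{k+1}=\frac{r_k}{1+\eta\frac{F'_k}{F_k}\|\nabla f(x_k)\|^2},\qquad x_{k+1}=x_k-\eta\frac{r_{k+1}}{F_k}\nabla f(x_k).$$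
   Formalization: The claim that r_k is strictly decreasing fails for constant f (r_k is then constant); it is replaced by: r_k is non-increasing, and r_{k+1} < r_k holds exactly when F'_k and the gradient of f at x_k are both nonzero. *)

theory Defs
  imports "HOL-Analysis.Analysis"
begin

definition grad :: "(real ^ 'd \<Rightarrow> real) \<Rightarrow> real ^ 'd \<Rightarrow> real ^ 'd" where
  "grad f x = (THE g. GDERIV f x :> g)"

lemma grad_eqI:
  fixes f :: "real ^ 'd \<Rightarrow> real"
  assumes "GDERIV f x :> g"
  shows "grad f x = g"
  unfolding grad_def
proof (rule the_equality)
  fix h assume "GDERIV f x :> h"
  then have "(\<lambda>v. v \<bullet> h) = (\<lambda>v. v \<bullet> g)"
    using assms unfolding gderiv_def by (rule has_derivative_unique)
  then show "h = g"
    by (metis inner_commute vector_eq_ldot)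
qed (rule assms)

lemma GDERIV_grad:
  fixes f :: "real ^ 'd \<Rightarrow> real"
  assumes "f differentiable (at x)"
  shows "GDERIV f x :> grad f x"
proof -
  obtain D where D: "(f has_derivative D) (at x)"
    using assms unfolding differentiable_def by blast
  then have "D = (\<lambda>v. v \<bullet> adjoint D 1)"
    using adjoint_works[OF has_derivative_linear[OF D], of _ 1] by (auto simp: inner_commute)
  then have "GDERIV f x :> adjoint D 1"
    using D unfolding gderiv_def by simp
  then show ?thesis
    using grad_eqI by metis
qed

definition Fval :: "(real ^ 'd \<Rightarrow> real) \<Rightarrow> real \<Rightarrow> (real \<Rightarrow> real) \<Rightarrow> (nat \<Rightarrow> real ^ 'd) \<Rightarrow> nat \<Rightarrow> real" where
  "Fval f c F x k = F (f (x k) + c)"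

definition Fderiv :: "(real ^ 'd \<Rightarrow> real) \<Rightarrow> real \<Rightarrow> (real \<Rightarrow> real) \<Rightarrow> (nat \<Rightarrow> real ^ 'd) \<Rightarrow> nat \<Rightarrow> real" where
  "Fderiv f c F x k = deriv F (f (x k) + c)"

text \<open>The starting point \<open>x 0\<close> is arbitrary; the iterates are determined by
  \<open>x 0\<close> and \<open>r 0\<close>.\<close>

definition gAEGD ::
  "(real ^ 'd \<Rightarrow> real) \<Rightarrow> real \<Rightarrow> (real \<Rightarrow> real) \<Rightarrow> real \<Rightarrow> (nat \<Rightarrow> real ^ 'd) \<Rightarrow> (nat \<Rightarrow> real) \<Rightarrow> bool" where
  "gAEGD f c F \<eta> x r \<longleftrightarrow>
     r 0 > 0 \<and>
     (\<forall>k. r (Suc k) = r k / (1 + \<eta> * (Fderiv f c F x k / Fval f c F x k) * (norm (grad f (x k)))\<^sup>2) \<and>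
          x (Suc k) = x k - (\<eta> * (r (Suc k) / Fval f c F x k)) *\<^sub>R grad f (x k))"

text \<open>Unconditional energy stability: whatever the step size and the initial data, the
  energy \<open>r\<^sub>k\<^sup>2\<close> never increases.\<close>

definition unconditionally_energy_stable ::
  "(real ^ 'd \<Rightarrow> real) \<Rightarrow> real \<Rightarrow> (real \<Rightarrow> real) \<Rightarrow> bool" where
  "unconditionally_energy_stable f c F \<longleftrightarrow>
     (\<forall>\<eta>>0. \<forall>x r. gAEGD f c F \<eta> x r \<longrightarrow> (\<forall>k. (r (Suc k))\<^sup>2 \<le> (r k)\<^sup>2))"

end

theory Submission
  imports Defs
begin

text \<open>Write \<open>a k\<close> for the term added to 1 in the denominator of the
  \<open>r\<close> update. A strictly increasing \<open>F\<close> has derivative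
  \<open>\<ge> 0\<close>, so \<open>a k \<ge> 0\<close> for every step size: \<open>r\<close> stays
  positive and never increases, hence converges to a limit \<open>\<ge> 0\<close>. Since the
  derivative of \<open>F\<close> may vanish at isolated points, a step is strict exactly when
  \<open>a k > 0\<close>, that is, when neither the derivative nor the gradient is zero. The energy
  identity is algebra: the update of \<open>r\<close> gives
  \<open>r k - r (Suc k) = r (Suc k) * a k\<close>, and the update of \<open>x\<close> turns
  \<open>r (Suc k) * (r (Suc k) * a k)\<close> into a multiple of the squared step length
  (\<open>energy_identity\<close>).\<close>

lemma deriv_nonneg_of_strict_mono_on:
  fixes F :: "real \<Rightarrow> real"
  assumes "strict_mono_on {a<..} F" "F differentiable (at u)" "u > a"
  shows "deriv F u \<ge> 0"
proof (rule mono_on_imp_deriv_nonneg)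
  show "mono_on {a<..} F"
    using assms(1) by (rule strict_mono_on_imp_mono_on)
  show "(F has_real_derivative deriv F u) (at u)"
    using assms(2) by (simp add: DERIV_deriv_iff_real_differentiable)
  show "u \<in> interior {a<..}"
    using assms(3) by (simp add: interior_open)
qed

text \<open>One step in isolation, with \<open>p\<close>, \<open>q\<close>, \<open>g\<close>
  standing for the value of \<open>F\<close>, its derivative and the gradient. The new value
  \<open>s\<close> occurs in both updates, so the drop \<open>r - s\<close> times \<open>s\<close>
  is quadratic in \<open>y - x\<close>.\<close>

lemma energy_identity:
  fixes g :: "'a::real_inner" and x y :: 'a and r s \<eta> p q :: real
  assumes "\<eta> > 0" "p > 0" "q \<ge> 0"
    and s: "s = r / (1 + \<eta> * (q / p) * (norm g)\<^sup>2)"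
    and y: "y = x - (\<eta> * (s / p)) *\<^sub>R g"
  shows "s\<^sup>2 = r\<^sup>2 - (s - r)\<^sup>2 - 2 / \<eta> * p * q * (norm (y - x))\<^sup>2"
proof -
  have "1 + \<eta> * (q / p) * (norm g)\<^sup>2 > 0"
    using assms(1-3) by (intro add_pos_nonneg) auto
  then have r: "r - s = s * (\<eta> * (q / p) * (norm g)\<^sup>2)"
    unfolding s by (simp add: field_simps)
  have "(norm (y - x))\<^sup>2 = \<eta>\<^sup>2 * s\<^sup>2 / p\<^sup>2 * (norm g)\<^sup>2"
    unfolding y by (simp add: power_mult_distrib power_divide)
  then have "2 / \<eta> * p * q * (norm (y - x))\<^sup>2 = 2 * s * (s * (\<eta> * (q / p) * (norm g)\<^sup>2))"
    using assms(1,2) by (simp add: field_simps power2_eq_square)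
  also have "\<dots> = 2 * s * (r - s)"
    by (simp only: r)
  \<comment> \<open>What remains is \<open>2 * s * (r - s) = r^2 - s^2 - (s - r)^2\<close>.\<close>
  finally show ?thesis
    by (simp add: power2_eq_square algebra_simps)
qed

theorem theorem2p1:
  fixes f :: "real ^ 'd \<Rightarrow> real" and F :: "real \<Rightarrow> real" and c :: real
  assumes f_diff: "\<And>z. f differentiable (at z)"
    and f_bdd: "bdd_below (range f)"
    and c: "(INF z. f z) + c > 0"
    and F_pos: "\<And>u. u > 0 \<Longrightarrow> F u > 0"
    and F_diff: "\<And>u. u > 0 \<Longrightarrow> F differentiable (at u)"
    and F_mono: "strict_mono_on {0<..} F"
  shows "unconditionally_energy_stable f c F \<and>
    (\<forall>\<eta> x r. \<eta> > 0 \<longrightarrow> gAEGD f c F \<eta> x r \<longrightarrow>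
      (\<forall>k. (r (Suc k))\<^sup>2 = (r k)\<^sup>2 - (r (Suc k) - r k)\<^sup>2
             - 2 / \<eta> * Fval f c F x k * Fderiv f c F x k * (norm (x (Suc k) - x k))\<^sup>2) \<and>
      decseq r \<and>
      (\<forall>k. r (Suc k) < r k \<longleftrightarrow> Fderiv f c F x k \<noteq> 0 \<and> grad f (x k) \<noteq> 0) \<and>
      (\<exists>rlim\<ge>0. r \<longlonglongrightarrow> rlim))"
proof -
  \<comment> \<open>Keeps every argument of \<open>F\<close> in the half-line where \<open>F\<close>
    is positive and differentiable.\<close>
  have arg_pos: "f z + c > 0" for z
    using c cINF_lower[OF f_bdd, of z] by simp
  \<comment> \<open>Positivity of \<open>r\<close> stands in for the limit here: it serves both the
    comparison of squares and the lower bound 0 in the convergence argument.\<close>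
  have *: "(\<forall>k. (r (Suc k))\<^sup>2 = (r k)\<^sup>2 - (r (Suc k) - r k)\<^sup>2
             - 2 / \<eta> * Fval f c F x k * Fderiv f c F x k * (norm (x (Suc k) - x k))\<^sup>2) \<and>
      decseq r \<and>
      (\<forall>k. r (Suc k) < r k \<longleftrightarrow> Fderiv f c F x k \<noteq> 0 \<and> grad f (x k) \<noteq> 0) \<and>
      (\<forall>k. r k > 0)" if "\<eta> > 0" and upd: "gAEGD f c F \<eta> x r" for \<eta> x r
  proof -
    define a where "a k = \<eta> * (Fderiv f c F x k / Fval f c F x k) * (norm (grad f (x k)))\<^sup>2" for k
    have r_Suc: "r (Suc k) = r k / (1 + a k)" for k
      using upd unfolding gAEGD_def a_def by blast
    have x_Suc: "x (Suc k) = x k - (\<eta> * (r (Suc k) / Fval f c F x k)) *\<^sub>R grad f (x k)" for k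
      using upd unfolding gAEGD_def by blast
    have p: "Fval f c F x k > 0" for k
      unfolding Fval_def by (intro F_pos arg_pos)
    have q: "Fderiv f c F x k \<ge> 0" for k
      unfolding Fderiv_def
      by (intro deriv_nonneg_of_strict_mono_on[OF F_mono] F_diff arg_pos)
    have a_nonneg: "a k \<ge> 0" for k
      unfolding a_def using p[of k] q[of k] \<open>\<eta> > 0\<close> by simp
    have a_pos_iff: "a k > 0 \<longleftrightarrow> Fderiv f c F x k \<noteq> 0 \<and> grad f (x k) \<noteq> 0" for k
    proof -
      have "a k \<noteq> 0 \<longleftrightarrow> Fderiv f c F x k \<noteq> 0 \<and> grad f (x k) \<noteq> 0"
        unfolding a_def using p[of k] \<open>\<eta> > 0\<close> by auto
      then show ?thesis
        using a_nonneg[of k] by linarith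
    qed
    have r_pos: "r k > 0" for k
    proof (induction k)
      case 0
      then show ?case using upd unfolding gAEGD_def by blast
    next
      case (Suc k)
      then show ?case using a_nonneg[of k] by (simp add: r_Suc)
    qed
    \<comment> \<open>The implicit form of the update: as \<open>r (Suc k) > 0\<close>, the drop has
      the sign of \<open>a k\<close>, which settles both monotonicity and strictness.\<close>
    have drop: "r k - r (Suc k) = r (Suc k) * a k" for k
      using a_nonneg[of k] by (simp add: r_Suc field_simps)
    have "decseq r"
    proof (rule decseq_SucI)
      fix k
      have "0 \<le> r (Suc k) * a k"
        using r_pos[of "Suc k"] a_nonneg[of k] by simp
      then show "r (Suc k) \<le> r k"
        using drop[of k] by linarith
    qed
    moreover have "r (Suc k) < r k \<longleftrightarrow> Fderiv f c F x k \<noteq> 0 \<and> grad f (x k) \<noteq> 0" for k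
    proof -
      have "r (Suc k) < r k \<longleftrightarrow> 0 < r (Suc k) * a k"
        using drop[of k] by linarith
      then show ?thesis
        using r_pos[of "Suc k"] a_pos_iff[of k] by (simp add: zero_less_mult_iff)
    qed
    moreover have "(r (Suc k))\<^sup>2 = (r k)\<^sup>2 - (r (Suc k) - r k)\<^sup>2
             - 2 / \<eta> * Fval f c F x k * Fderiv f c F x k * (norm (x (Suc k) - x k))\<^sup>2" for k
      using \<open>\<eta> > 0\<close> p q r_Suc[of k, unfolded a_def] x_Suc by (rule energy_identity)
    ultimately show ?thesis
      using r_pos by blast
  qed
  have "unconditionally_energy_stable f c F"
    unfolding unconditionally_energy_stable_def
  proof (intro allI impI)
    fix \<eta> :: real and x r k
    assume "\<eta> > 0" "gAEGD f c F \<eta> x r"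
    from *[OF this] have "r (Suc k) \<le> r k" "0 \<le> r (Suc k)"
      by (auto simp: decseq_Suc_iff intro: less_imp_le)
    then show "(r (Suc k))\<^sup>2 \<le> (r k)\<^sup>2"
      by (rule power_mono)
  qed
  moreover have "\<exists>rlim\<ge>0. r \<longlonglongrightarrow> rlim" if dec: "decseq r" and pos: "\<forall>k. r k > 0" for r :: "nat \<Rightarrow> real"
  proof -
    obtain L where "r \<longlonglongrightarrow> L" "\<forall>k. L \<le> r k"
      using decseq_convergent[OF dec, of 0] pos less_imp_le by blast
    moreover from this(1) have "0 \<le> L"
      using pos by (intro LIMSEQ_le_const) (auto intro: less_imp_le)
    ultimately show ?thesis by blast
  qed
  ultimately show ?thesis
    using * by blast
qed

end
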